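(* Let $k$ be an algebraically closed field and let $Q$ be a finite quiver whose underlying graph is a tree. Let $q:Q_1\to k^*=k\setminus\{0\}$ be a function on the set of arrows $Q_1$ of $Q$ (so $q(\alpha)\neq 0$ for each arrow $\alpha$). Then there is an isomorphism of $k$-algebras \[\Lambda^{co}_{Q,q}\stackrel{\sim}{\longrightarrow}\Lambda^{co}_{Q,1},\] where $1$ denotes the constant function on $Q_1$ with value $1$.
   Context: The doubled quiver $\overline{Q}$ of $Q$ is obtained from $Q$ by adding, for every arrow $\alpha:i\to j$ of $Q$, a new arrow $\alpha^*:j\to i$. $k\overline{Q}$ is its path algebra, with paths composed from right to left (for $\alpha:i\to j$ one has $\alpha=e_j\alpha e_i$, where $e_i$ is the idempotent of the vertex $i$). For a function $q:Q_1\to k$ and $\alpha\in Q_1$, the generalised commutator is $[\alpha,\alpha^*]_{q(\alpha)}=\alpha^*\alpha-q(\alpha)\,\alpha\alpha^*$. Put $\rho_q=\sum_{\alpha\in Q_1}[\alpha,\alpha^*]_{q(\alpha)}\in k\overline{Q}$ and $\Lambda^{co}_{Q,q}=k\overline{Q}/\langle\rho_q\rangle$, where $\langle\rho_q\rangle$ is the two-sided ideal generated by $\rho_q$. *)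

theory Defs
  imports
    "HOL-Computational_Algebra.Polynomial"
    "HOL-Library.Poly_Mapping"
    "Graph_Theory.Digraph_Component"
    "HOL-Algebra.QuotRing"
    "HOL-Algebra.Module"
begin

section \<open>Path algebras\<close>

text \<open>
  A quiver is a \<^typ>\<open>('a, 'b) pre_digraph\<close>: loops and parallel arrows are allowed.
  A path is a triple of its source, the list of its arrows in the order in which they are
  traversed, and its target; the trivial path at \<open>i\<close> is \<open>(i, [], i)\<close>.
\<close>

type_synonym ('a, 'b) qpath = "'a \<times> 'b list \<times> 'a"

definition qpaths :: "('a, 'b) pre_digraph \<Rightarrow> ('a, 'b) qpath set" where
  "qpaths G = {(u, p, v). pre_digraph.awalk G u p v}"

text \<open>
  Paths compose from right to left, so in a product \<open>x y\<close> the path \<open>y\<close> is traversed first,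
  and its arrows come first in the list.
\<close>

definition qpath_mult ::
  "('a, 'b) qpath \<Rightarrow> ('a, 'b) qpath \<Rightarrow> (('a, 'b) qpath \<Rightarrow>\<^sub>0 'k::field)" where
  "qpath_mult x y = (case (x, y) of ((v', p, w), (u, r, v)) \<Rightarrow>
     if v = v' then Poly_Mapping.single (u, r @ p, w) 1 else 0)"

definition pm_scale :: "'k::field \<Rightarrow> ('p \<Rightarrow>\<^sub>0 'k) \<Rightarrow> ('p \<Rightarrow>\<^sub>0 'k)" where
  "pm_scale c f = Poly_Mapping.map ((*) c) f"

text \<open>
  The field of scalars is a type, whereas the algebra is a record with an explicit carrier
  because it depends on the quiver. The ring multiplication that the type of finitely
  supported functions may carry as a class instance is not used.
\<close>

definition path_algebra ::
  "('a, 'b) pre_digraph \<Rightarrow> ('k::field, ('a, 'b) qpath \<Rightarrow>\<^sub>0 'k) module" where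
  "path_algebra G =
    \<lparr>carrier = {f. Poly_Mapping.keys f \<subseteq> qpaths G},
     mult = (\<lambda>f g. \<Sum>x\<in>Poly_Mapping.keys f. \<Sum>y\<in>Poly_Mapping.keys g.
               pm_scale (Poly_Mapping.lookup f x * Poly_Mapping.lookup g y) (qpath_mult x y)),
     one = (\<Sum>i\<in>verts G. Poly_Mapping.single (i, [], i) 1),
     zero = 0,
     add = (+),
     smult = pm_scale\<rparr>"

definition arrow ::
  "('a, 'b) pre_digraph \<Rightarrow> 'b \<Rightarrow> (('a, 'b) qpath \<Rightarrow>\<^sub>0 'k::field)" where
  "arrow G a = Poly_Mapping.single (tail G a, [a], head G a) 1"


section \<open>Quotients and isomorphisms of algebras\<close>

text \<open>
  The scalar multiple of a coset is written without choosing a representative, as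
  \<^const>\<open>rcoset_mult\<close> does for the product.
\<close>

definition quot_algebra :: "('k, 'c) module \<Rightarrow> 'c set \<Rightarrow> ('k, 'c set) module" where
  "quot_algebra A I =
     ring.extend (A Quot I) (module.fields (\<lambda>c X. \<Union>x\<in>X. I +>\<^bsub>A\<^esub> (c \<odot>\<^bsub>A\<^esub> x)))"

definition algebra_iso :: "('k, 'c) module \<Rightarrow> ('k, 'd) module \<Rightarrow> ('c \<Rightarrow> 'd) set" where
  "algebra_iso A B =
     {h \<in> ring_iso A B. \<forall>c. \<forall>x\<in>carrier A. h (c \<odot>\<^bsub>A\<^esub> x) = c \<odot>\<^bsub>B\<^esub> h x}"


section \<open>The doubled quiver and trees\<close>

datatype 'b double_arc = Orig (base_arc: 'b) | Star (base_arc: 'b)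

definition double_quiver :: "('a, 'b) pre_digraph \<Rightarrow> ('a, 'b double_arc) pre_digraph" where
  "double_quiver Q =
    \<lparr>verts = verts Q,
     arcs = Orig ` arcs Q \<union> Star ` arcs Q,
     tail = case_double_arc (tail Q) (head Q),
     head = case_double_arc (head Q) (tail Q)\<rparr>"

text \<open>
  Walks in the underlying graph of \<open>Q\<close>, a multigraph with one edge for each arrow, are
  walks in the doubled quiver. A cycle of the underlying graph must not use an edge twice
  (otherwise every edge would give a cycle of length two); loops and pairs of parallel
  or opposite arrows are cycles. The library predicate \<open>tree\<close> is not suitable here, since it
  only excludes directed cycles. The predicate \<open>connected\<close> is about the underlying
  graph and includes that there is a vertex.
\<close>

definition underlying_cycle :: "('a, 'b) pre_digraph \<Rightarrow> 'b double_arc list \<Rightarrow> bool" where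
  "underlying_cycle Q p \<longleftrightarrow>
     pre_digraph.cycle (double_quiver Q) p \<and> distinct (map base_arc p)"

definition underlying_tree :: "('a, 'b) pre_digraph \<Rightarrow> bool" where
  "underlying_tree Q \<longleftrightarrow> connected Q \<and> (\<nexists>p. underlying_cycle Q p)"


section \<open>The algebra\<close>

definition gen_commutator ::
  "('a, 'b) pre_digraph \<Rightarrow> 'k::field \<Rightarrow> 'b \<Rightarrow> (('a, 'b double_arc) qpath \<Rightarrow>\<^sub>0 'k)" where
  "gen_commutator Q c \<alpha> =
    (let A = path_algebra (double_quiver Q);
         a = arrow (double_quiver Q) (Orig \<alpha>);
         a' = arrow (double_quiver Q) (Star \<alpha>)
     in a' \<otimes>\<^bsub>A\<^esub> a - c \<odot>\<^bsub>A\<^esub> (a \<otimes>\<^bsub>A\<^esub> a'))"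

definition rho ::
  "('a, 'b) pre_digraph \<Rightarrow> ('b \<Rightarrow> 'k::field) \<Rightarrow> (('a, 'b double_arc) qpath \<Rightarrow>\<^sub>0 'k)" where
  "rho Q q = (\<Sum>\<alpha>\<in>arcs Q. gen_commutator Q (q \<alpha>) \<alpha>)"

definition Lambda_co ::
  "('a, 'b) pre_digraph \<Rightarrow> ('b \<Rightarrow> 'k::field)
     \<Rightarrow> ('k, (('a, 'b double_arc) qpath \<Rightarrow>\<^sub>0 'k) set) module" where
  "Lambda_co Q q =
    (let A = path_algebra (double_quiver Q) in quot_algebra A (Idl\<^bsub>A\<^esub> {rho Q q}))"

end

theory Submission
  imports Defs
begin

text \<open>
  Since \<open>Q\<close> is a tree, there are nonzero scalars \<open>\<mu>\<close> on the vertices that satisfy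
  \<open>\<mu> (head \<alpha>) = q \<alpha> * \<mu> (tail \<alpha>)\<close>. Let \<open>\<phi>\<close> be the automorphism of the path algebra of the
  doubled quiver that multiplies each arrow \<open>\<alpha>\<close> of \<open>Q\<close> by \<open>\<mu> (tail \<alpha>)\<close> and fixes the new arrows.
  Then \<open>\<phi>\<close> sends \<open>rho Q q\<close> to the product of the unit \<open>\<Sum>i. \<mu> i e\<^sub>i\<close> and \<open>rho Q 1\<close>, so it maps the
  ideal generated by the first relation onto the ideal generated by the second.
\<close>

section \<open>Quotients by ideals\<close>

text \<open>Preimages of ideals under ring homomorphisms are ideals, so minimality of the generated
  ideal, applied to \<open>h\<close> and to its inverse \<open>g\<close>, gives one inclusion
  each.\<close>

lemma ring_iso_image_genideal:
  assumes "ring R" "ring S" and h: "h \<in> ring_iso R S" and X: "X \<subseteq> carrier R"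
  shows "h ` (Idl\<^bsub>R\<^esub> X) = Idl\<^bsub>S\<^esub> (h ` X)"
proof -
  interpret R: ring R by fact
  interpret S: ring S by fact
  define g where "g = inv_into (carrier R) h"
  have g: "g \<in> ring_iso S R"
    unfolding g_def using assms(1) h by (rule ring_iso_set_sym)
  interpret h: ring_hom_ring R S h
    using h by unfold_locales (simp add: ring_iso_def)
  interpret g: ring_hom_ring S R g
    using g by unfold_locales (simp add: ring_iso_def)
  have bij: "bij_betw h (carrier R) (carrier S)"
    using h by (simp add: ring_iso_def)
  have gh: "g (h x) = x" if "x \<in> carrier R" for x
    using bij that unfolding g_def by (rule bij_betw_inv_into_left)
  have hg: "h (g y) = y" if "y \<in> carrier S" for y
    using bij that unfolding g_def by (rule bij_betw_inv_into_right)
  have hX: "h ` X \<subseteq> carrier S" using X by auto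
  have IX: "ideal (Idl\<^bsub>R\<^esub> X) R" by (rule R.genideal_ideal[OF X])
  have IhX: "ideal (Idl\<^bsub>S\<^esub> (h ` X)) S" by (rule S.genideal_ideal[OF hX])
  have 1: "Idl\<^bsub>R\<^esub> X \<subseteq> {r \<in> carrier R. h r \<in> Idl\<^bsub>S\<^esub> (h ` X)}"
    using X S.genideal_self[OF hX]
    by (intro R.genideal_minimal h.ideal_vimage[OF IhX]) auto
  have 2: "Idl\<^bsub>S\<^esub> (h ` X) \<subseteq> {s \<in> carrier S. g s \<in> Idl\<^bsub>R\<^esub> X}"
  proof (intro S.genideal_minimal g.ideal_vimage[OF IX] image_subsetI CollectI conjI)
    fix x assume x: "x \<in> X"
    then show "h x \<in> carrier S" using hX by auto
    show "g (h x) \<in> Idl\<^bsub>R\<^esub> X"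
      using x X gh[of x] R.genideal_self[OF X] by (metis subsetD)
  qed
  show ?thesis
  proof
    show "h ` (Idl\<^bsub>R\<^esub> X) \<subseteq> Idl\<^bsub>S\<^esub> (h ` X)" using 1 by blast
    show "Idl\<^bsub>S\<^esub> (h ` X) \<subseteq> h ` (Idl\<^bsub>R\<^esub> X)"
    proof
      fix y assume "y \<in> Idl\<^bsub>S\<^esub> (h ` X)"
      then have "g y \<in> Idl\<^bsub>R\<^esub> X" "h (g y) = y" using 2 hg by blast+
      then show "y \<in> h ` (Idl\<^bsub>R\<^esub> X)" by (metis imageI)
    qed
  qed
qed

text \<open>Each of the two generators is a left multiple of the other, by \<open>u\<close> or by
  \<open>inv u\<close>. This removes the unit factor that rescaling leaves in front of the
  relation.\<close>

lemma (in ring) genideal_Units_mult: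
  assumes u: "u \<in> Units R" and x: "x \<in> carrier R"
  shows "Idl {u \<otimes> x} = Idl {x}"
proof
  have ux: "u \<otimes> x \<in> carrier R" using u x by auto
  interpret I: ideal "Idl {x}" R using x by (intro genideal_ideal) auto
  interpret J: ideal "Idl {u \<otimes> x}" R using ux by (intro genideal_ideal) auto
  have "u \<otimes> x \<in> Idl {x}"
    using u x genideal_self'[OF x] by (intro I.I_l_closed) auto
  then show "Idl {u \<otimes> x} \<subseteq> Idl {x}"
    by (intro genideal_minimal I.is_ideal) auto
  have "inv u \<otimes> (u \<otimes> x) \<in> Idl {u \<otimes> x}"
    by (rule J.I_l_closed[OF genideal_self'[OF ux] Units_inv_closed[OF u]])
  moreover have "inv u \<otimes> (u \<otimes> x) = x"
    using u x by (metis Units_closed Units_inv_closed Units_l_inv l_one m_assoc)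
  ultimately have "x \<in> Idl {u \<otimes> x}" by metis
  then show "Idl {x} \<subseteq> Idl {u \<otimes> x}"
    by (intro genideal_minimal J.is_ideal) auto
qed

lemma quot_algebra_simps [simp]:
  "carrier (quot_algebra A I) = a_rcosets\<^bsub>A\<^esub> I"
  "mult (quot_algebra A I) = rcoset_mult A I"
  "one (quot_algebra A I) = I +>\<^bsub>A\<^esub> \<one>\<^bsub>A\<^esub>"
  "add (quot_algebra A I) = set_add A"
  "smult (quot_algebra A I) = (\<lambda>c X. \<Union>x\<in>X. I +>\<^bsub>A\<^esub> (c \<odot>\<^bsub>A\<^esub> x))"
  by (simp_all add: quot_algebra_def FactRing_def ring.defs module.defs)

text \<open>Transport of structure: the operations of the quotient are unions over the elements of
  cosets, so taking images under \<open>h\<close> respects them once it respects the formation of a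
  single coset. The target is the quotient by the image of \<open>I\<close>; identifying that image
  is a separate matter.\<close>

lemma image_algebra_iso_quot_algebra:
  assumes "ring A" and h: "h \<in> algebra_iso A B" and I: "I \<subseteq> carrier A"
    and smult: "\<And>c x. x \<in> carrier A \<Longrightarrow> c \<odot>\<^bsub>A\<^esub> x \<in> carrier A"
  shows "image h \<in> algebra_iso (quot_algebra A I) (quot_algebra B (h ` I))"
proof -
  interpret A: ring A by fact
  have h': "h \<in> ring_iso A B"
    and h_smult: "\<And>c x. x \<in> carrier A \<Longrightarrow> h (c \<odot>\<^bsub>A\<^esub> x) = c \<odot>\<^bsub>B\<^esub> h x"
    using h by (auto simp: algebra_iso_def)
  have bij: "bij_betw h (carrier A) (carrier B)"
    using h' by (simp add: ring_iso_def)
  have h_one: "h \<one>\<^bsub>A\<^esub> = \<one>\<^bsub>B\<^esub>"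
    and h_add: "\<And>x y. x \<in> carrier A \<Longrightarrow> y \<in> carrier A \<Longrightarrow> h (x \<oplus>\<^bsub>A\<^esub> y) = h x \<oplus>\<^bsub>B\<^esub> h y"
    and h_mult: "\<And>x y. x \<in> carrier A \<Longrightarrow> y \<in> carrier A \<Longrightarrow> h (x \<otimes>\<^bsub>A\<^esub> y) = h x \<otimes>\<^bsub>B\<^esub> h y"
    using h' by (auto simp: ring_iso_def ring_hom_def)
  have coset: "h ` (I +>\<^bsub>A\<^esub> a) = (h ` I) +>\<^bsub>B\<^esub> h a" if "a \<in> carrier A" for a
  proof -
    have "h ` (I +>\<^bsub>A\<^esub> a) = (\<Union>i\<in>I. {h (i \<oplus>\<^bsub>A\<^esub> a)})"
      by (auto simp: a_r_coset_def')
    also have "\<dots> = (\<Union>i\<in>I. {h i \<oplus>\<^bsub>B\<^esub> h a})"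
      using that I by (intro SUP_cong refl) (simp add: h_add subset_iff)
    finally show ?thesis by (auto simp: a_r_coset_def')
  qed
  have rcosets: "X \<subseteq> carrier A" if "X \<in> a_rcosets\<^bsub>A\<^esub> I" for X
    using that I by (auto simp: A_RCOSETS_def' a_r_coset_def')
  have "image h ` (a_rcosets\<^bsub>A\<^esub> I) = (\<lambda>a. (h ` I) +>\<^bsub>B\<^esub> h a) ` carrier A"
    by (auto simp: A_RCOSETS_def' image_UN coset)
  also have "\<dots> = (\<lambda>b. (h ` I) +>\<^bsub>B\<^esub> b) ` carrier B"
    unfolding bij_betw_imp_surj_on[OF bij, symmetric] by (simp add: image_image)
  also have "\<dots> = a_rcosets\<^bsub>B\<^esub> (h ` I)"
    by (auto simp: A_RCOSETS_def')
  finally have surj: "image h ` (a_rcosets\<^bsub>A\<^esub> I) = a_rcosets\<^bsub>B\<^esub> (h ` I)" .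
  \<comment> \<open>A map that is injective on the carrier separates subsets of the carrier, and
    cosets are such subsets.\<close>
  have "inj_on (image h) (a_rcosets\<^bsub>A\<^esub> I)"
    using inj_on_image_eq_iff[OF bij_betw_imp_inj_on[OF bij]] rcosets
    by (intro inj_onI) simp
  with surj have bij_image: "bij_betw (image h) (a_rcosets\<^bsub>A\<^esub> I) (a_rcosets\<^bsub>B\<^esub> (h ` I))"
    by (simp add: bij_betw_def)
  have image_mult: "h ` rcoset_mult A I X Y = rcoset_mult B (h ` I) (h ` X) (h ` Y)"
    if "X \<subseteq> carrier A" "Y \<subseteq> carrier A" for X Y
  proof -
    have "h ` rcoset_mult A I X Y = (\<Union>x\<in>X. \<Union>y\<in>Y. h ` (I +>\<^bsub>A\<^esub> (x \<otimes>\<^bsub>A\<^esub> y)))"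
      by (simp add: rcoset_mult_def image_UN)
    also have "\<dots> = (\<Union>x\<in>X. \<Union>y\<in>Y. (h ` I) +>\<^bsub>B\<^esub> (h x \<otimes>\<^bsub>B\<^esub> h y))"
      using that by (intro SUP_cong refl) (simp add: coset h_mult subset_iff)
    finally show ?thesis by (simp add: rcoset_mult_def)
  qed
  have image_add: "h ` (X <+>\<^bsub>A\<^esub> Y) = h ` X <+>\<^bsub>B\<^esub> h ` Y"
    if "X \<subseteq> carrier A" "Y \<subseteq> carrier A" for X Y
  proof -
    have "h ` (X <+>\<^bsub>A\<^esub> Y) = (\<Union>x\<in>X. \<Union>y\<in>Y. {h (x \<oplus>\<^bsub>A\<^esub> y)})"
      by (auto simp: set_add_def')
    also have "\<dots> = (\<Union>x\<in>X. \<Union>y\<in>Y. {h x \<oplus>\<^bsub>B\<^esub> h y})"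
      using that by (intro SUP_cong refl) (simp add: h_add subset_iff)
    finally show ?thesis by (auto simp: set_add_def')
  qed
  have image_smult: "h ` (\<Union>x\<in>X. I +>\<^bsub>A\<^esub> (c \<odot>\<^bsub>A\<^esub> x)) = (\<Union>y\<in>h ` X. (h ` I) +>\<^bsub>B\<^esub> (c \<odot>\<^bsub>B\<^esub> y))"
    if "X \<subseteq> carrier A" for c X
  proof -
    have "h ` (\<Union>x\<in>X. I +>\<^bsub>A\<^esub> (c \<odot>\<^bsub>A\<^esub> x)) = (\<Union>x\<in>X. h ` (I +>\<^bsub>A\<^esub> (c \<odot>\<^bsub>A\<^esub> x)))"
      by (simp add: image_UN)
    also have "\<dots> = (\<Union>x\<in>X. (h ` I) +>\<^bsub>B\<^esub> (c \<odot>\<^bsub>B\<^esub> h x))"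
      using that smult by (intro SUP_cong refl) (simp add: coset h_smult subset_iff)
    finally show ?thesis by simp
  qed
  show ?thesis
    unfolding algebra_iso_def ring_iso_def quot_algebra_simps
  proof (intro CollectI conjI allI ballI bij_image image_smult rcosets)
    have "h ` X \<in> a_rcosets\<^bsub>B\<^esub> (h ` I)" if "X \<in> a_rcosets\<^bsub>A\<^esub> I" for X
      using that surj by blast
    then show "image h \<in> ring_hom (quot_algebra A I) (quot_algebra B (h ` I))"
      by (intro ring_hom_memI)
         (simp_all add: image_mult image_add rcosets coset[OF A.one_closed] h_one)
  qed
qed

section \<open>Potentials on trees\<close>

lemma double_quiver_simps [simp]:
  "verts (double_quiver Q) = verts Q"
  "arcs (double_quiver Q) = Orig ` arcs Q \<union> Star ` arcs Q"
  "tail (double_quiver Q) (Orig a) = tail Q a"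
  "tail (double_quiver Q) (Star a) = head Q a"
  "head (double_quiver Q) (Orig a) = head Q a"
  "head (double_quiver Q) (Star a) = tail Q a"
  by (simp_all add: double_quiver_def)

lemma fin_digraph_double_quiver:
  assumes "fin_digraph Q"
  shows "fin_digraph (double_quiver Q)"
proof -
  interpret fin_digraph Q by fact
  show ?thesis by unfold_locales auto
qed

text \<open>Connectedness is expressed by \<open>mk_symmetric\<close>, whose arcs are mere pairs of
  vertices. Reachability depends only on which pairs are joined, and these are the same pairs in the
  doubled quiver.\<close>

lemma connected_double_quiver_awalk:
  assumes "fin_digraph Q" "connected Q" "u \<in> verts Q" "v \<in> verts Q"
  shows "\<exists>p. pre_digraph.awalk (double_quiver Q) u p v"
proof -
  interpret D: fin_digraph "double_quiver Q"
    using assms(1) by (rule fin_digraph_double_quiver)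
  have "arcs_ends (mk_symmetric Q) = arcs_ends (double_quiver Q)"
    by (auto simp: parcs_mk_symmetric arcs_ends_def arc_to_ends_def image_Un image_image)
  moreover have "u \<rightarrow>\<^sup>*\<^bsub>mk_symmetric Q\<^esub> v"
    using assms by (auto simp: connected_def strongly_connected_def)
  ultimately have "u \<rightarrow>\<^sup>*\<^bsub>double_quiver Q\<^esub> v"
    by (simp add: reachable_def)
  then show ?thesis by (simp add: D.reachable_awalk)
qed

text \<open>
  A shortest closed walk of weight different from 1 would be a cycle. On a tree it therefore
  uses some edge twice; cutting it there leaves two shorter closed walks.
\<close>

lemma closed_awalk_weight_eq_1:
  fixes w :: "'b double_arc \<Rightarrow> 'k::field"
  assumes "fin_digraph Q" and acyclic: "\<nexists>p. underlying_cycle Q p"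
    and w: "\<And>a. a \<in> arcs Q \<Longrightarrow> w (Orig a) * w (Star a) = 1"
    and "pre_digraph.awalk (double_quiver Q) u p u"
  shows "prod_list (map w p) = 1"
proof -
  interpret D: fin_digraph "double_quiver Q"
    using assms(1) by (rule fin_digraph_double_quiver)
  show ?thesis
    using assms(4)
  proof (induction p arbitrary: u rule: length_induct)
    case (1 p)
    have IH: "prod_list (map w p') = 1" if "length p' < length p" "D.awalk v p' v" for p' v
      using 1 that by blast
    show ?case
    proof (cases p)
      case (Cons e es)
      have es: "D.awalk (head (double_quiver Q) e) es u"
        and u: "u = tail (double_quiver Q) e" and e: "e \<in> arcs (double_quiver Q)"
        using 1(2) unfolding Cons D.awalk_Cons_iff by blast+
      \<comment> \<open>A closed walk lists its starting vertex at both ends, hence the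
        \<open>tl\<close>. A repetition in what remains cuts out a nonempty closed subwalk
        \<open>r\<close>; both \<open>r\<close> and the rest of the walk are shorter than
        \<open>p\<close>.\<close>
      show ?thesis
      proof (cases "distinct (tl (D.awalk_verts u p))")
        case False
        then have "\<not> distinct (D.awalk_verts (head (double_quiver Q) e) es)"
          using Cons by simp
        from D.awalk_not_distinct_decomp[OF es this]
        obtain q r s v where dec: "es = q @ r @ s" "0 < length r"
          "D.awalk (head (double_quiver Q) e) q v" "D.awalk v r v" "D.awalk v s u" by blast
        have "D.awalk u (e # q @ s) u"
          using dec u e by (auto simp only: D.awalk_Cons_iff intro: D.awalk_appendI)
        then have "prod_list (map w (e # q @ s)) = 1"
          using dec Cons by (intro IH) auto
        moreover have "prod_list (map w r) = 1"
          using dec Cons by (intro IH[of _ v]) auto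
        ultimately show ?thesis using dec Cons by (simp add: mult_ac)
      next
        case True
        then have "D.cycle p" using 1(2) Cons by (auto simp: D.cycle_def)
        then have "\<not> distinct (map base_arc p)"
          using acyclic by (auto simp: underlying_cycle_def)
        then obtain xs ys zs b where "map base_arc p = xs @ [b] @ ys @ [b] @ zs"
          using not_distinct_decomp by blast
        then obtain xs e ys f zs where p: "p = xs @ e # ys @ f # zs" and ef: "base_arc e = base_arc f"
          by (auto simp: map_eq_append_conv map_eq_Cons_conv append_eq_map_conv Cons_eq_map_conv)
        from 1(2) p have W: "D.awalk u xs (tail (double_quiver Q) e)"
          "e \<in> arcs (double_quiver Q)" "f \<in> arcs (double_quiver Q)"
          "D.awalk (head (double_quiver Q) e) ys (tail (double_quiver Q) f)"
          "D.awalk (head (double_quiver Q) f) zs u"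
          by (auto simp: D.awalk_Cons_iff)
        \<comment> \<open>The edge is crossed twice. If the directions agree, the walk splits into
          the shorter closed walks \<open>e # ys\<close> and \<open>xs @ f # zs\<close>. If they are
          opposite, \<open>ys\<close> is closed at the head of \<open>e\<close>, the weights of
          \<open>e\<close> and \<open>f\<close> cancel, and deleting this detour leaves the closed
          walk \<open>xs @ zs\<close>.\<close>
        show ?thesis
        proof (cases "e = f")
          case True
          have "D.awalk (tail (double_quiver Q) e) (e # ys) (tail (double_quiver Q) e)"
            using W True by (simp add: D.awalk_Cons_iff)
          then have "prod_list (map w (e # ys)) = 1"
            using p by (intro IH) auto
          moreover have "D.awalk u (xs @ f # zs) u"
            using W True by (intro D.awalk_appendI[OF W(1)]) (simp add: D.awalk_Cons_iff)
          then have "prod_list (map w (xs @ f # zs)) = 1"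
            using p by (intro IH) auto
          moreover have "prod_list (map w p) =
              prod_list (map w (e # ys)) * prod_list (map w (xs @ f # zs))"
            using p by (simp add: mult_ac)
          ultimately show ?thesis by simp
        next
          case False
          obtain a where a: "a \<in> arcs Q"
            and "e = Orig a \<and> f = Star a \<or> e = Star a \<and> f = Orig a"
            using W ef False by auto
          then have ht: "tail (double_quiver Q) f = head (double_quiver Q) e"
              "head (double_quiver Q) f = tail (double_quiver Q) e"
            and wef: "w e * w f = 1"
            using w[OF a] by (auto simp: mult.commute)
          have "prod_list (map w ys) = 1"
            using W p ht by (intro IH[of _ "head (double_quiver Q) e"]) auto
          moreover have "D.awalk u (xs @ zs) u"
            using W ht by (intro D.awalk_appendI[OF W(1)]) simp
          then have "prod_list (map w (xs @ zs)) = 1"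
            using p by (intro IH) auto
          ultimately show ?thesis using p wef by (simp add: mult_ac)
        qed
      qed
    qed simp
  qed
qed

text \<open>The potential at a vertex is the weight of a walk to it from a root \<open>r\<close>,
  where an arrow counts with \<open>q\<close> if followed and with the inverse if traversed
  backwards. Closed walks on a tree have weight 1, so the choice of the walk does not
  matter.\<close>

lemma underlying_tree_potential:
  fixes q :: "'b \<Rightarrow> 'k::field"
  assumes "fin_digraph Q" "underlying_tree Q" and q: "\<forall>\<alpha>\<in>arcs Q. q \<alpha> \<noteq> 0"
  obtains \<mu> where "\<And>v. \<mu> v \<noteq> 0" "\<And>\<alpha>. \<alpha> \<in> arcs Q \<Longrightarrow> \<mu> (head Q \<alpha>) = q \<alpha> * \<mu> (tail Q \<alpha>)"
proof -
  interpret Q: fin_digraph Q by fact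
  interpret D: fin_digraph "double_quiver Q"
    using assms(1) by (rule fin_digraph_double_quiver)
  have conn: "connected Q" and acyclic: "\<nexists>p. underlying_cycle Q p"
    using assms(2) by (auto simp: underlying_tree_def)
  obtain r where r: "r \<in> verts Q"
    using conn by (auto simp: connected_def strongly_connected_def)
  define w where "w = case_double_arc q (\<lambda>a. inverse (q a))"
  have w_simps: "w (Orig a) = q a" "w (Star a) = inverse (q a)" for a
    by (simp_all add: w_def)
  define wt where "wt = (\<lambda>p. prod_list (map w p))"
  have closed: "wt p = 1" if "D.awalk u p u" for u p
    unfolding wt_def using assms(1) acyclic _ that
    by (rule closed_awalk_weight_eq_1) (simp add: w_simps q)
  obtain P where P: "\<And>v. v \<in> verts Q \<Longrightarrow> D.awalk r (P v) v"
    using connected_double_quiver_awalk[OF assms(1) conn r] by metis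
  \<comment> \<open>Return walks to the root turn walks from the root into closed walks of weight 1.
    This makes \<open>wt (P v)\<close> nonzero and allows two walks to the same vertex to be
    compared.\<close>
  obtain P' where P': "\<And>v. v \<in> verts Q \<Longrightarrow> D.awalk v (P' v) r"
    using connected_double_quiver_awalk[OF assms(1) conn _ r] by metis
  have PP': "wt (P v) * wt (P' v) = 1" if "v \<in> verts Q" for v
    using closed[OF D.awalk_appendI[OF P[OF that] P'[OF that]]] by (simp add: wt_def)
  \<comment> \<open>The value 1 off the vertices keeps \<open>\<mu>\<close> nonzero everywhere:
    \<open>rescale_algebra_iso\<close> asks for nonzero factors at all labels, also at those that
    are not arcs.\<close>
  define \<mu> where "\<mu> = (\<lambda>v. if v \<in> verts Q then wt (P v) else 1)"
  show thesis
  proof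
    show "\<mu> v \<noteq> 0" for v
      using PP'[of v] by (auto simp: \<mu>_def)
    fix a assume a: "a \<in> arcs Q"
    have "D.awalk (tail Q a) (Orig a # P' (head Q a)) r"
      using a P'[of "head Q a"] by (simp add: D.awalk_Cons_iff)
    \<comment> \<open>The walk through the tail of \<open>a\<close> and the chosen walk to its head
      are closed by the same return walk, whose nonzero weight then cancels.\<close>
    from closed[OF D.awalk_appendI[OF P this]] a
    have "wt (P (tail Q a)) * q a * wt (P' (head Q a)) = 1"
      by (simp add: wt_def w_simps mult.assoc)
    moreover have "wt (P (head Q a)) * wt (P' (head Q a)) = 1"
      using a PP' by simp
    ultimately have "wt (P (head Q a)) = wt (P (tail Q a)) * q a"
      by (metis mult_cancel_right mult_zero_right zero_neq_one)
    then show "\<mu> (head Q a) = q a * \<mu> (tail Q a)"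
      using a by (simp add: \<mu>_def mult.commute)
  qed
qed

section \<open>The path algebra as a ring\<close>

lemma lookup_pm_scale [simp]:
  "Poly_Mapping.lookup (pm_scale c f) x = c * Poly_Mapping.lookup f x"
  by (simp add: pm_scale_def Poly_Mapping.map.rep_eq when_def)

lemma pm_scale_single [simp]:
  "pm_scale c (Poly_Mapping.single x a) = Poly_Mapping.single x (c * a)"
  by (intro poly_mapping_eqI) (simp add: lookup_single when_def)

lemma pm_scale_zero_left [simp]: "pm_scale 0 f = 0"
  and pm_scale_zero_right [simp]: "pm_scale c 0 = 0"
  by (auto intro: poly_mapping_eqI)

lemma pm_scale_add_left: "pm_scale (c + d) f = pm_scale c f + pm_scale d f"
  by (intro poly_mapping_eqI) (simp add: lookup_add algebra_simps)

text \<open>Reduces statements that are additive in an argument to basis elements. The set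
  \<open>K\<close> serves statements about elements supported on genuine paths, such as the unit
  laws.\<close>

lemma poly_mapping_single_induct [consumes 1, case_names zero single add]:
  fixes f :: "'a \<Rightarrow>\<^sub>0 'b::comm_monoid_add"
  assumes "Poly_Mapping.keys f \<subseteq> K" and zero: "P 0"
    and single: "\<And>x c. x \<in> K \<Longrightarrow> P (Poly_Mapping.single x c)"
    and add: "\<And>f g. P f \<Longrightarrow> P g \<Longrightarrow> P (f + g)"
  shows "P f"
proof -
  have "P (\<Sum>x\<in>X. Poly_Mapping.single x (Poly_Mapping.lookup f x))" if "X \<subseteq> K" for X
    using that by (induction X rule: infinite_finite_induct) (auto intro: zero single add)
  moreover have "(\<Sum>x\<in>Poly_Mapping.keys f. Poly_Mapping.single x (Poly_Mapping.lookup f x)) = f"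
    by (intro poly_mapping_eqI) (simp add: lookup_sum lookup_single when_def in_keys_iff)
  ultimately show ?thesis using assms(1) by metis
qed

lemmas poly_mapping_single_induct_UNIV [case_names zero single add] =
  poly_mapping_single_induct[OF subset_UNIV]

lemma path_algebra_simps [simp]:
  "carrier (path_algebra G) = {f. Poly_Mapping.keys f \<subseteq> qpaths G}"
  "one (path_algebra G) = (\<Sum>i\<in>verts G. Poly_Mapping.single (i, [], i) 1)"
  "zero (path_algebra G) = 0"
  "add (path_algebra G) = (+)"
  "smult (path_algebra G) = pm_scale"
  by (simp_all add: path_algebra_def)

text \<open>The product is a sum over supports, and these change under addition. Summing over a
  common finite superset adds only zero terms and makes distributivity a termwise matter.\<close>

lemma path_algebra_mult_superset:
  assumes "finite X" "Poly_Mapping.keys f \<subseteq> X" "finite Y" "Poly_Mapping.keys g \<subseteq> Y"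
  shows "f \<otimes>\<^bsub>path_algebra G\<^esub> g = (\<Sum>x\<in>X. \<Sum>y\<in>Y.
    pm_scale (Poly_Mapping.lookup f x * Poly_Mapping.lookup g y) (qpath_mult x y))"
proof -
  have "f \<otimes>\<^bsub>path_algebra G\<^esub> g = (\<Sum>x\<in>Poly_Mapping.keys f. \<Sum>y\<in>Poly_Mapping.keys g.
      pm_scale (Poly_Mapping.lookup f x * Poly_Mapping.lookup g y) (qpath_mult x y))"
    by (simp add: path_algebra_def)
  also have "\<dots> = (\<Sum>x\<in>Poly_Mapping.keys f. \<Sum>y\<in>Y.
      pm_scale (Poly_Mapping.lookup f x * Poly_Mapping.lookup g y) (qpath_mult x y))"
    using assms by (intro sum.cong refl sum.mono_neutral_left) (auto simp: in_keys_iff)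
  also have "\<dots> = (\<Sum>x\<in>X. \<Sum>y\<in>Y.
      pm_scale (Poly_Mapping.lookup f x * Poly_Mapping.lookup g y) (qpath_mult x y))"
    using assms by (intro sum.mono_neutral_left) (auto simp: in_keys_iff)
  finally show ?thesis .
qed

lemma path_algebra_mult_zero [simp]:
  "0 \<otimes>\<^bsub>path_algebra G\<^esub> f = 0" "f \<otimes>\<^bsub>path_algebra G\<^esub> 0 = 0"
  by (simp_all add: path_algebra_def)

lemma path_algebra_l_distr:
  "(f + g) \<otimes>\<^bsub>path_algebra G\<^esub> h = f \<otimes>\<^bsub>path_algebra G\<^esub> h + g \<otimes>\<^bsub>path_algebra G\<^esub> h"
proof -
  let ?X = "Poly_Mapping.keys f \<union> Poly_Mapping.keys g"
  show ?thesis
    by (simp add: path_algebra_mult_superset[of ?X _ "Poly_Mapping.keys h"] keys_add lookup_add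
        distrib_right pm_scale_add_left sum.distrib)
qed

lemma path_algebra_r_distr:
  "h \<otimes>\<^bsub>path_algebra G\<^esub> (f + g) = h \<otimes>\<^bsub>path_algebra G\<^esub> f + h \<otimes>\<^bsub>path_algebra G\<^esub> g"
proof -
  let ?Y = "Poly_Mapping.keys f \<union> Poly_Mapping.keys g"
  show ?thesis
    by (simp add: path_algebra_mult_superset[of "Poly_Mapping.keys h" _ ?Y] keys_add lookup_add
        distrib_left pm_scale_add_left sum.distrib)
qed

lemma path_algebra_sum_mult:
  "(\<Sum>i\<in>I. f i) \<otimes>\<^bsub>path_algebra G\<^esub> h = (\<Sum>i\<in>I. f i \<otimes>\<^bsub>path_algebra G\<^esub> h)"
  by (induction I rule: infinite_finite_induct) (simp_all add: path_algebra_l_distr)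

lemma path_algebra_mult_sum:
  "h \<otimes>\<^bsub>path_algebra G\<^esub> (\<Sum>i\<in>I. f i) = (\<Sum>i\<in>I. h \<otimes>\<^bsub>path_algebra G\<^esub> f i)"
  by (induction I rule: infinite_finite_induct) (simp_all add: path_algebra_r_distr)

lemma path_algebra_mult_single:
  "Poly_Mapping.single (v', p, w) a \<otimes>\<^bsub>path_algebra G\<^esub> Poly_Mapping.single (u, r, v) b =
    (if v = v' then Poly_Mapping.single (u, r @ p, w) (a * b) else 0)"
  by (simp add: path_algebra_mult_superset[of "{(v', p, w)}" _ "{(u, r, v)}"] qpath_mult_def)

text \<open>By additivity in all three arguments this reduces to associativity of list
  concatenation, together with the matching of end points.\<close>

lemma path_algebra_m_assoc:
  "(f \<otimes>\<^bsub>path_algebra G\<^esub> g) \<otimes>\<^bsub>path_algebra G\<^esub> h =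
    f \<otimes>\<^bsub>path_algebra G\<^esub> (g \<otimes>\<^bsub>path_algebra G\<^esub> h)"
proof (induction f rule: poly_mapping_single_induct_UNIV)
  case (single x a)
  show ?case
  proof (induction g rule: poly_mapping_single_induct_UNIV)
    case (single y b)
    show ?case
    proof (induction h rule: poly_mapping_single_induct_UNIV)
      case (single z c)
      show ?case
        by (cases x; cases y; cases z) (simp add: path_algebra_mult_single mult.assoc)
    qed (simp_all add: path_algebra_r_distr)
  qed (simp_all add: path_algebra_l_distr path_algebra_r_distr)
qed (simp_all add: path_algebra_l_distr)

lemma (in wf_digraph) path_algebra_mult_closed:
  assumes "f \<in> carrier (path_algebra G)" "g \<in> carrier (path_algebra G)"
  shows "f \<otimes>\<^bsub>path_algebra G\<^esub> g \<in> carrier (path_algebra G)"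
proof -
  have add: "f + g \<in> carrier (path_algebra G)"
    if "f \<in> carrier (path_algebra G)" "g \<in> carrier (path_algebra G)"
    for f g :: "('a, 'b) qpath \<Rightarrow>\<^sub>0 'k::field"
    using that keys_add[of f g] by auto
  have "Poly_Mapping.keys f \<subseteq> qpaths G" using assms by simp
  then show ?thesis
  proof (induction f rule: poly_mapping_single_induct)
    case (single x a)
    have "Poly_Mapping.keys g \<subseteq> qpaths G" using assms by simp
    then show ?case
    proof (induction g rule: poly_mapping_single_induct)
      case (single y b)
      obtain v' p w u r v where [simp]: "x = (v', p, w)" "y = (u, r, v)"
        by (cases x; cases y)
      have "awalk u (r @ p) w" if "v = v'"
        using \<open>x \<in> _\<close> \<open>y \<in> _\<close> that by (auto simp: qpaths_def simp del: awalk_append_iff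
            intro: awalk_appendI)
      then show ?case by (auto simp: path_algebra_mult_single qpaths_def)
    qed (simp_all only: path_algebra_r_distr add, simp)
  qed (simp_all only: path_algebra_l_distr add, simp)
qed

text \<open>One notion for the identity, where \<open>\<mu>\<close> is constantly 1, and for the
  unit that relates the two relations.\<close>

definition vertex_sum :: "('a, 'b) pre_digraph \<Rightarrow> ('a \<Rightarrow> 'k::field) \<Rightarrow> (('a, 'b) qpath \<Rightarrow>\<^sub>0 'k)" where
  "vertex_sum G \<mu> = (\<Sum>i\<in>verts G. Poly_Mapping.single (i, [], i) (\<mu> i))"

lemma path_algebra_one: "one (path_algebra G) = vertex_sum G (\<lambda>_. 1)"
  by (simp add: vertex_sum_def)

context fin_digraph
begin

lemma vertex_sum_closed: "vertex_sum G \<mu> \<in> carrier (path_algebra G)"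
proof -
  have "Poly_Mapping.lookup (vertex_sum G \<mu>) x = 0" if "x \<notin> qpaths G" for x
    using that unfolding vertex_sum_def lookup_sum lookup_single
    by (intro sum.neutral) (auto simp: qpaths_def awalk_Nil_iff when_def)
  then show ?thesis by (auto simp: in_keys_iff)
qed

text \<open>Since paths compose from right to left, a left factor meets the target of a path, and
  only the idempotent at that vertex survives.\<close>

lemma vertex_sum_mult_single:
  assumes "v \<in> verts G"
  shows "vertex_sum G \<mu> \<otimes>\<^bsub>path_algebra G\<^esub> Poly_Mapping.single (u, p, v) a =
    Poly_Mapping.single (u, p, v) (\<mu> v * a)"
proof -
  have "vertex_sum G \<mu> \<otimes>\<^bsub>path_algebra G\<^esub> Poly_Mapping.single (u, p, v) a =
    (\<Sum>i\<in>verts G. if v = i then Poly_Mapping.single (u, p, i) (\<mu> i * a) else 0)"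
    by (simp add: vertex_sum_def path_algebra_sum_mult path_algebra_mult_single)
  then show ?thesis using assms by simp
qed

lemma single_mult_vertex_sum:
  assumes "u \<in> verts G"
  shows "Poly_Mapping.single (u, p, v) a \<otimes>\<^bsub>path_algebra G\<^esub> vertex_sum G \<mu> =
    Poly_Mapping.single (u, p, v) (a * \<mu> u)"
proof -
  have "Poly_Mapping.single (u, p, v) a \<otimes>\<^bsub>path_algebra G\<^esub> vertex_sum G \<mu> =
    (\<Sum>i\<in>verts G. if i = u then Poly_Mapping.single (i, p, v) (a * \<mu> i) else 0)"
    by (simp add: vertex_sum_def path_algebra_mult_sum path_algebra_mult_single)
  then show ?thesis using assms by simp
qed

lemma vertex_sum_mult_vertex_sum:
  "vertex_sum G \<mu> \<otimes>\<^bsub>path_algebra G\<^esub> vertex_sum G \<nu> = vertex_sum G (\<lambda>i. \<mu> i * \<nu> i)"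
proof -
  have "vertex_sum G \<mu> \<otimes>\<^bsub>path_algebra G\<^esub> vertex_sum G \<nu> =
    (\<Sum>i\<in>verts G. vertex_sum G \<mu> \<otimes>\<^bsub>path_algebra G\<^esub> Poly_Mapping.single (i, [], i) (\<nu> i))"
    by (simp add: vertex_sum_def[of G \<nu>] path_algebra_mult_sum)
  then show ?thesis by (simp add: vertex_sum_mult_single vertex_sum_def[of G "\<lambda>i. \<mu> i * \<nu> i"])
qed

lemma qpaths_ends:
  assumes "(u, p, v) \<in> qpaths G"
  shows "u \<in> verts G" "v \<in> verts G"
  using assms by (auto simp: qpaths_def)

lemma ring_path_algebra: "ring (path_algebra G :: ('k::field, _) module)"
proof (rule ringI)
  let ?A = "path_algebra G :: ('k, _) module"
  show "abelian_group ?A"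
  proof (rule abelian_groupI)
    show "\<exists>g\<in>carrier ?A. g \<oplus>\<^bsub>?A\<^esub> f = \<zero>\<^bsub>?A\<^esub>" if "f \<in> carrier ?A" for f
      using that by (intro bexI[of _ "- f"]) auto
    show "f \<oplus>\<^bsub>?A\<^esub> g \<in> carrier ?A" if "f \<in> carrier ?A" "g \<in> carrier ?A" for f g
      using that keys_add[of f g] by auto
  qed (simp_all add: add_ac)
  show "Group.monoid ?A"
  proof (rule monoidI)
    show "\<one>\<^bsub>?A\<^esub> \<in> carrier ?A"
      unfolding path_algebra_one by (rule vertex_sum_closed)
    \<comment> \<open>The unit laws use that both ends of a path are vertices of \<open>G\<close>,
      so that the identity contains the idempotents there.\<close>
    fix f assume "f \<in> carrier ?A"
    then have f: "Poly_Mapping.keys f \<subseteq> qpaths G" by simp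
    then show "\<one>\<^bsub>?A\<^esub> \<otimes>\<^bsub>?A\<^esub> f = f"
    proof (induction f rule: poly_mapping_single_induct)
      case (single x c)
      then show ?case
        using qpaths_ends(2) by (cases x) (auto simp del: path_algebra_simps(2)
            simp: path_algebra_one vertex_sum_mult_single)
    qed (simp_all add: path_algebra_r_distr)
    show "f \<otimes>\<^bsub>?A\<^esub> \<one>\<^bsub>?A\<^esub> = f"
      using f
    proof (induction f rule: poly_mapping_single_induct)
      case (single x c)
      then show ?case
        using qpaths_ends(1) by (cases x) (auto simp del: path_algebra_simps(2)
            simp: path_algebra_one single_mult_vertex_sum)
    qed (simp_all add: path_algebra_l_distr)
  qed (simp_all only: path_algebra_mult_closed path_algebra_m_assoc)
qed (simp_all add: path_algebra_l_distr path_algebra_r_distr)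

text \<open>The trivial paths are orthogonal idempotents, so inverting the coefficients gives the
  inverse.\<close>

lemma vertex_sum_Units:
  assumes "\<And>i. i \<in> verts G \<Longrightarrow> \<mu> i \<noteq> (0::'k::field)"
  shows "vertex_sum G \<mu> \<in> Units (path_algebra G)"
proof -
  have "vertex_sum G (\<lambda>i. inverse (\<mu> i) * \<mu> i) = \<one>\<^bsub>path_algebra G\<^esub>"
       "vertex_sum G (\<lambda>i. \<mu> i * inverse (\<mu> i)) = \<one>\<^bsub>path_algebra G\<^esub>"
    using assms by (auto simp: vertex_sum_def intro: sum.cong)
  then show ?thesis
    unfolding Units_def
    by (intro CollectI conjI bexI[of _ "vertex_sum G (\<lambda>i. inverse (\<mu> i))"] vertex_sum_closed)
       (simp_all only: vertex_sum_mult_vertex_sum)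
qed

end

section \<open>Rescaling the arrows\<close>

definition path_weight :: "('b \<Rightarrow> 'k::field) \<Rightarrow> ('a, 'b) qpath \<Rightarrow> 'k" where
  "path_weight c x = prod_list (map c (fst (snd x)))"

text \<open>The endomorphism that multiplies each arrow by its factor and fixes the trivial paths,
  given as a diagonal map in the basis of paths. Linearity is then a coefficientwise matter.\<close>

definition rescale ::
  "('b \<Rightarrow> 'k::field) \<Rightarrow> (('a, 'b) qpath \<Rightarrow>\<^sub>0 'k) \<Rightarrow> (('a, 'b) qpath \<Rightarrow>\<^sub>0 'k)" where
  "rescale c f = Abs_poly_mapping (\<lambda>x. path_weight c x * Poly_Mapping.lookup f x)"

lemma lookup_rescale [simp]:
  "Poly_Mapping.lookup (rescale c f) x = path_weight c x * Poly_Mapping.lookup f x"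
proof -
  have "finite {x. path_weight c x * Poly_Mapping.lookup f x \<noteq> 0}"
    by (rule finite_subset[OF _ finite_keys[of f]]) (auto simp: in_keys_iff)
  then show ?thesis by (simp add: rescale_def)
qed

lemma rescale_single:
  "rescale c (Poly_Mapping.single x a) = Poly_Mapping.single x (path_weight c x * a)"
  by (intro poly_mapping_eqI) (simp add: lookup_single when_def)

lemma rescale_zero [simp]: "rescale c 0 = 0"
  by (intro poly_mapping_eqI) simp

lemma rescale_add: "rescale c (f + g) = rescale c f + rescale c g"
  by (intro poly_mapping_eqI) (simp add: lookup_add algebra_simps)

lemma rescale_diff: "rescale c (f - g) = rescale c f - rescale c g"
  by (intro poly_mapping_eqI) (simp add: lookup_minus algebra_simps)

lemma rescale_sum: "rescale c (\<Sum>i\<in>I. f i) = (\<Sum>i\<in>I. rescale c (f i))"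
  by (induction I rule: infinite_finite_induct) (simp_all add: rescale_add)

text \<open>The weight of a concatenation is the product of the weights.\<close>

lemma rescale_mult:
  "rescale c (f \<otimes>\<^bsub>path_algebra G\<^esub> g) = rescale c f \<otimes>\<^bsub>path_algebra G\<^esub> rescale c g"
proof (induction f rule: poly_mapping_single_induct_UNIV)
  case (single x a)
  show ?case
  proof (induction g rule: poly_mapping_single_induct_UNIV)
    case (single y b)
    show ?case
      by (cases x; cases y)
         (simp add: path_algebra_mult_single rescale_single path_weight_def mult_ac)
  qed (simp_all add: path_algebra_r_distr rescale_add)
qed (simp_all add: path_algebra_l_distr rescale_add)

text \<open>Rescaling by the inverse factors is the inverse map. As no path has weight 0, both maps
  preserve supports and hence the carrier.\<close>

lemma rescale_algebra_iso:
  fixes c :: "'b \<Rightarrow> 'k::field"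
  assumes c: "\<And>a. c a \<noteq> 0"
  shows "rescale c \<in> algebra_iso (path_algebra G) (path_algebra G)"
proof -
  have weight_nz: "path_weight c x \<noteq> 0" for x :: "('a, 'b) qpath"
    using c by (auto simp: path_weight_def prod_list_zero_iff)
  have weight_inv: "path_weight (\<lambda>a. inverse (c a)) x = inverse (path_weight c x)"
    for x :: "('a, 'b) qpath"
  proof -
    have "prod_list (map (\<lambda>a. inverse (c a)) p) = inverse (prod_list (map c p))" for p
      by (induction p) simp_all
    then show ?thesis by (simp add: path_weight_def)
  qed
  have keys: "Poly_Mapping.keys (rescale c f) = Poly_Mapping.keys f"
    "Poly_Mapping.keys (rescale (\<lambda>a. inverse (c a)) f) = Poly_Mapping.keys f"
    for f :: "('a, 'b) qpath \<Rightarrow>\<^sub>0 'k"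
    by (auto simp: in_keys_iff weight_nz weight_inv)
  have "bij_betw (rescale c) (carrier (path_algebra G)) (carrier (path_algebra G))"
    by (rule bij_betw_byWitness[where f' = "rescale (\<lambda>a. inverse (c a))"])
       (auto simp: keys weight_nz weight_inv intro!: poly_mapping_eqI)
  moreover have "rescale c (pm_scale d f) = pm_scale d (rescale c f)" for d f
    by (intro poly_mapping_eqI) simp
  moreover have "rescale c \<one>\<^bsub>path_algebra G\<^esub> = \<one>\<^bsub>path_algebra G\<^esub>"
    by (simp add: rescale_sum rescale_single path_weight_def)
  ultimately show ?thesis
    by (auto simp: algebra_iso_def ring_iso_def keys rescale_add rescale_mult
        simp del: path_algebra_simps(2) intro!: ring_hom_memI)
qed

section \<open>The defining relation\<close>

text \<open>In the product of the starred arrow with the original one, the original is traversed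
  first; so this term is a closed path at the tail of \<open>a\<close>, and the other one is closed
  at the head.\<close>

lemma gen_commutator_eq:
  "gen_commutator Q c a =
    Poly_Mapping.single (tail Q a, [Orig a, Star a], tail Q a) 1 -
    Poly_Mapping.single (head Q a, [Star a, Orig a], head Q a) c"
  by (simp add: gen_commutator_def arrow_def path_algebra_mult_single)

lemma rho_eq:
  "rho Q q =
    (\<Sum>a\<in>arcs Q. Poly_Mapping.single (tail Q a, [Orig a, Star a], tail Q a) 1) -
    (\<Sum>a\<in>arcs Q. Poly_Mapping.single (head Q a, [Star a, Orig a], head Q a) (q a))"
  by (simp add: rho_def gen_commutator_eq sum_subtractf)

lemma rho_closed:
  assumes "fin_digraph Q"
  shows "rho Q q \<in> carrier (path_algebra (double_quiver Q))"
proof -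
  interpret Q: fin_digraph Q by fact
  interpret D: fin_digraph "double_quiver Q"
    using assms by (rule fin_digraph_double_quiver)
  have "Poly_Mapping.lookup (rho Q q) x = 0" if "x \<notin> qpaths (double_quiver Q)" for x
  proof -
    have "(tail Q a, [Orig a, Star a], tail Q a) \<noteq> x" "(head Q a, [Star a, Orig a], head Q a) \<noteq> x"
      if "a \<in> arcs Q" for a
      using that \<open>x \<notin> _\<close> by (auto simp: qpaths_def D.awalk_simps)
    then show ?thesis
      by (simp add: rho_eq lookup_minus lookup_sum lookup_single when_def cong: sum.cong_simp)
  qed
  then show ?thesis by (auto simp: in_keys_iff)
qed

text \<open>Each closed path in the relation contains \<open>Orig a\<close> once and
  \<open>Star a\<close> once, so rescaling multiplies it by \<open>\<mu> (tail Q a)\<close>. Left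
  multiplication by the vertex sum instead gives \<open>\<mu> (tail Q a)\<close> at the tail and
  \<open>\<mu> (head Q a)\<close> at the head; the potential equation says that the latter is
  \<open>q a * \<mu> (tail Q a)\<close>.\<close>

lemma rescale_rho:
  assumes "fin_digraph Q" and \<mu>: "\<And>a. a \<in> arcs Q \<Longrightarrow> \<mu> (head Q a) = q a * \<mu> (tail Q a)"
  shows "rescale (case_double_arc (\<lambda>a. \<mu> (tail Q a)) (\<lambda>_. 1)) (rho Q q) =
    vertex_sum (double_quiver Q) \<mu> \<otimes>\<^bsub>path_algebra (double_quiver Q)\<^esub> rho Q (\<lambda>_. 1)"
proof -
  interpret Q: fin_digraph Q by fact
  interpret D: fin_digraph "double_quiver Q"
    using assms(1) by (rule fin_digraph_double_quiver)
  let ?A = "path_algebra (double_quiver Q)"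
  have mult_diff: "f \<otimes>\<^bsub>?A\<^esub> (g - h) = f \<otimes>\<^bsub>?A\<^esub> g - f \<otimes>\<^bsub>?A\<^esub> h" for f g h
    using path_algebra_r_distr[of "double_quiver Q" f "g - h" h] by (simp add: algebra_simps)
  show ?thesis
    by (simp add: rho_eq rescale_diff rescale_sum rescale_single path_weight_def mult_diff
        path_algebra_mult_sum D.vertex_sum_mult_single \<mu> mult.commute cong: sum.cong_simp)
qed

theorem lemma2p5:
  fixes Q :: "('a, 'b) pre_digraph"
    and q :: "'b \<Rightarrow> 'k::alg_closed_field"
  assumes "fin_digraph Q"
    and "underlying_tree Q"
    and "\<forall>\<alpha>\<in>arcs Q. q \<alpha> \<noteq> 0"
  shows "\<exists>h. h \<in> algebra_iso (Lambda_co Q q) (Lambda_co Q (\<lambda>_. 1))"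
proof -
  interpret D: fin_digraph "double_quiver Q"
    using assms(1) by (rule fin_digraph_double_quiver)
  let ?A = "path_algebra (double_quiver Q) :: ('k, _) module"
  interpret A: ring ?A by (rule D.ring_path_algebra)
  obtain \<mu> where \<mu>_nz: "\<And>v. \<mu> v \<noteq> 0"
    and \<mu>: "\<And>\<alpha>. \<alpha> \<in> arcs Q \<Longrightarrow> \<mu> (head Q \<alpha>) = q \<alpha> * \<mu> (tail Q \<alpha>)"
    using underlying_tree_potential[OF assms] by metis
  define \<phi> :: "(('a, 'b double_arc) qpath \<Rightarrow>\<^sub>0 'k) \<Rightarrow> (('a, 'b double_arc) qpath \<Rightarrow>\<^sub>0 'k)"
    where "\<phi> = rescale (case_double_arc (\<lambda>a. \<mu> (tail Q a)) (\<lambda>_. 1))"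
  have \<phi>: "\<phi> \<in> algebra_iso ?A ?A"
    unfolding \<phi>_def using \<mu>_nz by (intro rescale_algebra_iso) (auto split: double_arc.split)
  then have \<phi>_ring: "\<phi> \<in> ring_iso ?A ?A" by (simp add: algebra_iso_def)
  have rho: "rho Q q \<in> carrier ?A" for q :: "'b \<Rightarrow> 'k"
    by (rule rho_closed[OF assms(1)])
  have "\<phi> ` (Idl\<^bsub>?A\<^esub> {rho Q q}) = Idl\<^bsub>?A\<^esub> {\<phi> (rho Q q)}"
    using ring_iso_image_genideal[OF A.ring_axioms A.ring_axioms \<phi>_ring, of "{rho Q q}"] rho
    by auto
  also have "\<dots> = Idl\<^bsub>?A\<^esub> {vertex_sum (double_quiver Q) \<mu> \<otimes>\<^bsub>?A\<^esub> rho Q (\<lambda>_. 1)}"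
    unfolding \<phi>_def by (simp add: rescale_rho[where \<mu> = \<mu>, OF assms(1) \<mu>])
  also have "\<dots> = Idl\<^bsub>?A\<^esub> {rho Q (\<lambda>_. 1)}"
    using \<mu>_nz rho by (intro A.genideal_Units_mult D.vertex_sum_Units) auto
  finally have "\<phi> ` (Idl\<^bsub>?A\<^esub> {rho Q q}) = Idl\<^bsub>?A\<^esub> {rho Q (\<lambda>_. 1)}" .
  moreover have "ideal (Idl\<^bsub>?A\<^esub> {rho Q q}) ?A"
    using rho by (intro A.genideal_ideal) auto
  then have "Idl\<^bsub>?A\<^esub> {rho Q q} \<subseteq> carrier ?A"
    by (rule additive_subgroup.a_subset[OF ideal.axioms(1)])
  moreover have "c \<odot>\<^bsub>?A\<^esub> f \<in> carrier ?A" if "f \<in> carrier ?A" for c f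
    using that by (auto simp: in_keys_iff subset_iff)
  \<comment> \<open>Since \<open>\<phi>\<close> carries one ideal onto the other, the induced
    isomorphism of the quotients sends a coset to its image as a set.\<close>
  ultimately have "image \<phi> \<in> algebra_iso (Lambda_co Q q) (Lambda_co Q (\<lambda>_. 1))"
    using image_algebra_iso_quot_algebra[OF A.ring_axioms \<phi>, of "Idl\<^bsub>?A\<^esub> {rho Q q}"]
    by (simp add: Lambda_co_def Let_def)
  then show ?thesis by blast
qed

end
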